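(* Let $X$ be a $T_0$ topological space. Then $X$ is well-filtered if and only if its upper space $\mathcal{D}(X)$ is well-filtered.
   Context: A subset of a topological space is saturated if it equals the intersection of all open sets containing it. Compact means every open cover has a finite subcover (no Hausdorff condition). A $T_0$ space $X$ is well-filtered if for every open set $U$ of $X$ and every filtered family $\mathcal{F}$ of saturated compact subsets of $X$ (i.e. $\mathcal{F}$ is nonempty and any two members of $\mathcal{F}$ contain a common member of $\mathcal{F}$), $\bigcap\mathcal{F}\subseteq U$ implies $F\subseteq U$ for some $F\in\mathcal{F}$. For a topological space $X$, $\mathcal{D}(X)$ denotes the set of all nonempty compact saturated subsets of $X$. The upper Vietoris topology on $\mathcal{D}(X)$ is the topology having as a base the sets $\Box U=\{K\in\mathcal{D}(X):K\subseteq U\}$, $U$ ranging over the open subsets of $X$. The upper space of $X$ is $\mathcal{D}(X)$ equipped with the upper Vietoris topology. *)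

theory Defs
  imports "HOL-Analysis.Analysis"
begin

text \<open>The conjunct \<open>S \<subseteq> topspace X\<close> makes the family in the intersection nonempty; without it,
  the intersection could be that of the empty family, which is \<open>UNIV\<close>.\<close>
definition saturated_in :: "'a topology \<Rightarrow> 'a set \<Rightarrow> bool" where
  "saturated_in X S \<longleftrightarrow> S \<subseteq> topspace X \<and> S = \<Inter>{U. openin X U \<and> S \<subseteq> U}"

definition filtered_family :: "'a set set \<Rightarrow> bool" where
  "filtered_family \<F> \<longleftrightarrow> \<F> \<noteq> {} \<and> (\<forall>A\<in>\<F>. \<forall>B\<in>\<F>. \<exists>C\<in>\<F>. C \<subseteq> A \<and> C \<subseteq> B)"

definition well_filtered_space :: "'a topology \<Rightarrow> bool" where
  "well_filtered_space X \<longleftrightarrow>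
     t0_space X \<and>
     (\<forall>U \<F>. openin X U \<longrightarrow> filtered_family \<F> \<longrightarrow>
        (\<forall>F\<in>\<F>. compactin X F \<and> saturated_in X F) \<longrightarrow>
        \<Inter>\<F> \<subseteq> U \<longrightarrow> (\<exists>F\<in>\<F>. F \<subseteq> U))"

definition upper_points :: "'a topology \<Rightarrow> 'a set set" where
  "upper_points X = {K. K \<noteq> {} \<and> compactin X K \<and> saturated_in X K}"

definition upper_box :: "'a topology \<Rightarrow> 'a set \<Rightarrow> 'a set set" where
  "upper_box X U = {K \<in> upper_points X. K \<subseteq> U}"

definition upper_space :: "'a topology \<Rightarrow> 'a set topology" where
  "upper_space X = topology (arbitrary union_of (\<lambda>B. \<exists>U. openin X U \<and> B = upper_box X U))"

lemma upper_box_Int: "upper_box X U \<inter> upper_box X V = upper_box X (U \<inter> V)"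
  by (auto simp: upper_box_def)

text \<open>\<open>topology\<close> is meaningful only for predicates satisfying \<open>istopology\<close>; the next lemmas show
  that this holds here and that the underlying set is the intended one.\<close>
lemma openin_upper_space:
  "openin (upper_space X) = arbitrary union_of (\<lambda>B. \<exists>U. openin X U \<and> B = upper_box X U)"
proof -
  have "istopology (arbitrary union_of (\<lambda>B. \<exists>U. openin X U \<and> B = upper_box X U))"
    by (rule istopology_base) (metis upper_box_Int openin_Int)
  then show ?thesis
    unfolding upper_space_def by (rule topology_inverse')
qed

lemma topspace_upper_space: "topspace (upper_space X) = upper_points X"
proof
  show "topspace (upper_space X) \<subseteq> upper_points X"
    unfolding topspace_def openin_upper_space union_of_def by (auto simp: upper_box_def)
  have "upper_points X = upper_box X (topspace X)"
    by (auto simp: upper_box_def upper_points_def dest: compactin_subset_topspace)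
  moreover have "openin (upper_space X) (upper_box X (topspace X))"
    unfolding openin_upper_space by (rule arbitrary_union_of_inc) blast
  ultimately show "upper_points X \<subseteq> topspace (upper_space X)"
    by (metis openin_subset)
qed

end

theory Submission
  imports Defs
begin

text \<open>If the upper space is well-filtered, a filtered family of compact saturated sets \<open>K\<close> is
  transported to the principal sets of all \<open>Q \<subseteq> K\<close>.

  Conversely, let a filtered family of compact saturated sets \<open>\<K>\<close> of the upper space be given, none
  contained in the open set \<open>\<U>\<close>. Enlarge \<open>\<U>\<close> to a maximal open \<open>\<W>\<close> containing no \<open>\<K>\<close>. The sets
  \<open>\<Union>(\<K> - \<W>)\<close> form a filtered family of nonempty compact saturated sets of \<open>X\<close>; their intersection
  \<open>L\<close> is a point of the upper space by well-filteredness, and lies outside \<open>\<W>\<close>. Maximality forces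
  every point outside \<open>\<W>\<close> to contain each \<open>k \<in> L\<close>, hence \<open>L\<close> itself, and so \<open>L\<close> belongs to every
  \<open>\<K>\<close>.\<close>

section \<open>Saturated sets and separation of points from them\<close>

lemma saturated_in_iff:
  "saturated_in X S \<longleftrightarrow>
     S \<subseteq> topspace X \<and> (\<forall>x \<in> topspace X - S. \<exists>U. openin X U \<and> S \<subseteq> U \<and> x \<notin> U)"
proof (cases "S \<subseteq> topspace X")
  case True
  define T where "T = \<Inter>{U. openin X U \<and> S \<subseteq> U}"
  have T: "x \<in> T \<longleftrightarrow> (\<forall>U. openin X U \<longrightarrow> S \<subseteq> U \<longrightarrow> x \<in> U)" for x
    by (simp add: T_def imp_conjL)
  have "S \<subseteq> T" "T \<subseteq> topspace X"
    using True T openin_topspace by blast+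
  then have "S = T \<longleftrightarrow> (\<forall>x \<in> topspace X - S. x \<notin> T)"
    by blast
  then show ?thesis
    using True by (simp add: saturated_in_def T_def[symmetric] T)
qed (simp add: saturated_in_def)

lemma saturated_inE:
  assumes "saturated_in X S" "x \<in> topspace X" "x \<notin> S"
  obtains U where "openin X U" "S \<subseteq> U" "x \<notin> U"
  using assms unfolding saturated_in_iff by blast

text \<open>A point outside the union is missed by some open neighbourhood of each member; choosing
  one per member, the union of these neighbourhoods is open and still misses the point.\<close>

lemma saturated_in_Union:
  assumes "\<And>S. S \<in> \<S> \<Longrightarrow> saturated_in X S"
  shows "saturated_in X (\<Union>\<S>)"
  unfolding saturated_in_iff
proof (intro conjI ballI)
  show "\<Union>\<S> \<subseteq> topspace X"
    using assms by (auto simp: saturated_in_iff)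
  fix x assume x: "x \<in> topspace X - \<Union>\<S>"
  then have "\<forall>S\<in>\<S>. \<exists>U. openin X U \<and> S \<subseteq> U \<and> x \<notin> U"
    using assms by (auto simp: saturated_in_iff)
  then obtain U where "\<forall>S\<in>\<S>. openin X (U S) \<and> S \<subseteq> U S \<and> x \<notin> U S"
    by metis
  then show "\<exists>U. openin X U \<and> \<Union>\<S> \<subseteq> U \<and> x \<notin> U"
    by (intro exI[of _ "\<Union>(U ` \<S>)"]) auto
qed

lemma saturated_in_Inter:
  assumes "\<S> \<noteq> {}" "\<And>S. S \<in> \<S> \<Longrightarrow> saturated_in X S"
  shows "saturated_in X (\<Inter>\<S>)"
  unfolding saturated_in_iff
proof (intro conjI ballI)
  show "\<Inter>\<S> \<subseteq> topspace X"
    using assms by (auto simp: saturated_in_iff)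
  fix x assume "x \<in> topspace X - \<Inter>\<S>"
  then obtain S where "S \<in> \<S>" "x \<in> topspace X" "x \<notin> S"
    by blast
  then obtain U where "openin X U" "S \<subseteq> U" "x \<notin> U"
    using assms(2) saturated_inE by metis
  then show "\<exists>U. openin X U \<and> \<Inter>\<S> \<subseteq> U \<and> x \<notin> U"
    using \<open>S \<in> \<S>\<close> by blast
qed

text \<open>An open set that misses \<open>x\<close> also misses the closure of \<open>{x}\<close>.
  In terms of the specialization order, \<open>S\<close> is an upper set and the closure is the set
  of points below \<open>x\<close>.\<close>

lemma saturated_in_disjoint_closure_of:
  assumes "saturated_in X S" "x \<in> topspace X"
  shows "S \<inter> X closure_of {x} = {} \<longleftrightarrow> x \<notin> S"
proof
  show "S \<inter> X closure_of {x} = {} \<Longrightarrow> x \<notin> S"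
    using assms(2) closure_of_subset[of "{x}" X] by auto
next
  assume "x \<notin> S"
  then obtain U where "openin X U" "S \<subseteq> U" "x \<notin> U"
    using assms saturated_inE by metis
  then show "S \<inter> X closure_of {x} = {}"
    by (auto simp: in_closure_of)
qed

section \<open>Open, saturated and compact sets of the upper space\<close>

lemma openin_upper_space_iff:
  "openin (upper_space X) \<V> \<longleftrightarrow>
     \<V> \<subseteq> upper_points X \<and> (\<forall>K\<in>\<V>. \<exists>U. openin X U \<and> K \<subseteq> U \<and> upper_box X U \<subseteq> \<V>)"
proof -
  have "(\<exists>B. (\<exists>U. openin X U \<and> B = upper_box X U) \<and> K \<in> B \<and> B \<subseteq> \<V>) \<longleftrightarrow>
      K \<in> upper_points X \<and> (\<exists>U. openin X U \<and> K \<subseteq> U \<and> upper_box X U \<subseteq> \<V>)" for K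
    unfolding upper_box_def by blast
  then show ?thesis
    unfolding openin_upper_space arbitrary_union_of_alt by (simp add: subset_iff) blast
qed

lemma openin_upper_box: "openin X U \<Longrightarrow> openin (upper_space X) (upper_box X U)"
  by (auto simp: openin_upper_space_iff upper_box_def)

text \<open>A basic neighbourhood \<open>upper_box X U\<close> of \<open>Q\<close> contains every
  point of the upper space lying inside \<open>Q\<close>. This is one half of the fact that
  specialization in the upper space is reverse inclusion.\<close>

lemma openin_upper_space_mono:
  assumes "openin (upper_space X) \<V>" "Q \<in> \<V>" "K \<subseteq> Q" "K \<in> upper_points X"
  shows "K \<in> \<V>"
proof -
  obtain U where "Q \<subseteq> U" "upper_box X U \<subseteq> \<V>"
    using assms(1,2) by (auto simp: openin_upper_space_iff)
  moreover have "K \<in> upper_box X U"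
    using assms(3,4) \<open>Q \<subseteq> U\<close> by (simp add: upper_box_def)
  ultimately show ?thesis
    by blast
qed

lemma saturated_in_upper_space_mono:
  assumes "saturated_in (upper_space X) \<K>" "Q \<in> \<K>" "K \<subseteq> Q" "K \<in> upper_points X"
  shows "K \<in> \<K>"
proof (rule ccontr)
  assume "K \<notin> \<K>"
  then obtain \<V> where "openin (upper_space X) \<V>" "\<K> \<subseteq> \<V>" "K \<notin> \<V>"
    using assms(1,4) saturated_inE by (metis topspace_upper_space)
  then show False
    using assms(2-4) openin_upper_space_mono by (metis subsetD)
qed

lemma t0_upper_space: "t0_space (upper_space X)"
proof -
  \<comment> \<open>Pick a point of \<open>K\<close> outside the saturated set \<open>Q\<close> and
    an open \<open>U\<close> around \<open>Q\<close> missing it; the box of \<open>U\<close>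
    contains \<open>Q\<close> but not \<open>K\<close>.\<close>
  have sep: "\<exists>\<V>. openin (upper_space X) \<V> \<and> Q \<in> \<V> \<and> K \<notin> \<V>"
    if K: "K \<in> upper_points X" and Q: "Q \<in> upper_points X" and KQ: "\<not> K \<subseteq> Q" for K Q
  proof -
    obtain x where x: "x \<in> K" "x \<notin> Q"
      using KQ by blast
    then have "x \<in> topspace X"
      using K by (auto simp: upper_points_def saturated_in_iff)
    moreover have "saturated_in X Q"
      using Q by (simp add: upper_points_def)
    ultimately obtain U where "openin X U" "Q \<subseteq> U" "x \<notin> U"
      using x(2) saturated_inE by metis
    then show ?thesis
      using x Q by (intro exI[of _ "upper_box X U"] conjI openin_upper_box) (auto simp: upper_box_def)
  qed
  show ?thesis
    unfolding t0_space_def topspace_upper_space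
    by (metis sep subset_antisym)
qed

text \<open>The box has \<open>K\<close> as its largest element, so a single member of the cover
  that contains \<open>K\<close> already covers the whole box.\<close>

lemma compactin_upper_box:
  assumes "K \<in> upper_points X"
  shows "compactin (upper_space X) (upper_box X K)"
  unfolding compactin_def
proof (intro conjI allI impI)
  show "upper_box X K \<subseteq> topspace (upper_space X)"
    by (auto simp: topspace_upper_space upper_box_def)
  fix \<C> assume \<C>: "Ball \<C> (openin (upper_space X)) \<and> upper_box X K \<subseteq> \<Union>\<C>"
  then obtain \<V> where "\<V> \<in> \<C>" "K \<in> \<V>"
    using assms by (auto simp: upper_box_def)
  then have "upper_box X K \<subseteq> \<V>"
    using \<C> openin_upper_space_mono[of X \<V> K] by (auto simp: upper_box_def)
  then show "\<exists>\<F>. finite \<F> \<and> \<F> \<subseteq> \<C> \<and> upper_box X K \<subseteq> \<Union>\<F>"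
    using \<open>\<V> \<in> \<C>\<close> by (intro exI[of _ "{\<V>}"]) auto
qed

lemma saturated_in_upper_box:
  assumes "saturated_in X K"
  shows "saturated_in (upper_space X) (upper_box X K)"
  unfolding saturated_in_iff topspace_upper_space
proof (intro conjI ballI)
  show "upper_box X K \<subseteq> upper_points X"
    by (auto simp: upper_box_def)
  fix Q assume Q: "Q \<in> upper_points X - upper_box X K"
  then obtain x where x: "x \<in> Q" "x \<notin> K"
    by (auto simp: upper_box_def)
  then have "x \<in> topspace X"
    using Q by (auto simp: upper_points_def saturated_in_iff)
  then obtain U where "openin X U" "K \<subseteq> U" "x \<notin> U"
    using x(2) assms saturated_inE by metis
  then show "\<exists>\<U>. openin (upper_space X) \<U> \<and> upper_box X K \<subseteq> \<U> \<and> Q \<notin> \<U>"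
    using x by (intro exI[of _ "upper_box X U"] conjI openin_upper_box) (auto simp: upper_box_def)
qed

text \<open>Each \<open>K\<close> in \<K> has a finite subcover \<open>\<F> K\<close> and lies in
  the box of its union. These boxes are an open cover of \<K>; finitely many suffice, and the
  corresponding finite subcovers together cover the union of \<K>.\<close>

lemma compactin_Union_upper_space:
  assumes "compactin (upper_space X) \<K>"
  shows "compactin X (\<Union>\<K>)"
  unfolding compactin_def
proof (intro conjI allI impI)
  have pts: "\<K> \<subseteq> upper_points X"
    using compactin_subset_topspace[OF assms] by (simp add: topspace_upper_space)
  then show "\<Union>\<K> \<subseteq> topspace X"
    by (auto simp: upper_points_def saturated_in_iff)
  fix \<C> assume \<C>: "Ball \<C> (openin X) \<and> \<Union>\<K> \<subseteq> \<Union>\<C>"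
  have "\<exists>\<F>. finite \<F> \<and> \<F> \<subseteq> \<C> \<and> K \<subseteq> \<Union>\<F>" if "K \<in> \<K>" for K
  proof -
    have "compactin X K" "K \<subseteq> \<Union>\<C>"
      using that pts \<C> by (auto simp: upper_points_def)
    then show ?thesis
      using \<C> compactinD[of X K \<C>] by simp
  qed
  then obtain \<F> where \<F>: "\<And>K. K \<in> \<K> \<Longrightarrow> finite (\<F> K) \<and> \<F> K \<subseteq> \<C> \<and> K \<subseteq> \<Union>(\<F> K)"
    by metis
  let ?box = "\<lambda>K. upper_box X (\<Union>(\<F> K))"
  have "\<forall>B \<in> ?box ` \<K>. openin (upper_space X) B"
  proof clarify
    fix K assume "K \<in> \<K>"
    then have "\<forall>U\<in>\<F> K. openin X U"
      using \<F> \<C> by auto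
    then show "openin (upper_space X) (?box K)"
      by (intro openin_upper_box openin_Union) auto
  qed
  moreover have "\<K> \<subseteq> \<Union>(?box ` \<K>)"
  proof
    fix K assume "K \<in> \<K>"
    then have "K \<in> ?box K"
      using \<F> pts by (auto simp: upper_box_def)
    then show "K \<in> \<Union>(?box ` \<K>)"
      using \<open>K \<in> \<K>\<close> by blast
  qed
  ultimately have "\<exists>\<G>. finite \<G> \<and> \<G> \<subseteq> ?box ` \<K> \<and> \<K> \<subseteq> \<Union>\<G>"
    by (intro compactinD[OF assms]) auto
  then obtain \<H> where \<H>: "finite \<H>" "\<H> \<subseteq> \<K>" "\<K> \<subseteq> \<Union>(?box ` \<H>)"
    by (metis finite_subset_image)
  have "\<Union>\<K> \<subseteq> \<Union>(\<Union>(\<F> ` \<H>))"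
  proof (rule Union_least)
    fix K assume "K \<in> \<K>"
    then obtain H where "H \<in> \<H>" "K \<in> upper_box X (\<Union>(\<F> H))"
      using \<H>(3) by blast
    then have "K \<subseteq> \<Union>(\<F> H)"
      by (simp add: upper_box_def)
    then show "K \<subseteq> \<Union>(\<Union>(\<F> ` \<H>))"
      using \<open>H \<in> \<H>\<close> by blast
  qed
  moreover have "finite (\<Union>(\<F> ` \<H>))"
    using \<H>(1,2) \<F> by (intro finite_UN_I) auto
  moreover have "\<Union>(\<F> ` \<H>) \<subseteq> \<C>"
    using \<H>(2) \<F> by (intro UN_least) auto
  ultimately show "\<exists>\<F>. finite \<F> \<and> \<F> \<subseteq> \<C> \<and> \<Union>\<K> \<subseteq> \<Union>\<F>"
    by blast
qed

section \<open>Maximal open sets by Zorn's lemma\<close>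

lemma compactin_subset_Union_chain:
  assumes "compactin Y K" "\<And>U. U \<in> \<C> \<Longrightarrow> openin Y U" "K \<subseteq> \<Union>\<C>" "\<C> \<noteq> {}"
    and chain: "subset.chain \<A> \<C>"
  shows "\<exists>U\<in>\<C>. K \<subseteq> U"
proof -
  obtain \<F> where \<F>: "finite \<F>" "\<F> \<subseteq> \<C>" "K \<subseteq> \<Union>\<F>"
    using compactinD[OF assms(1-3)] by metis
  show ?thesis
  proof (cases "\<F> = {}")
    \<comment> \<open>Here \<open>K\<close> is empty, so any member of the nonempty chain serves;
      otherwise the finite chain \<F> has its union as a member.\<close>
    case True
    then show ?thesis
      using \<F> \<open>\<C> \<noteq> {}\<close> by auto
  next
    case False
    moreover have "subset.chain \<A> \<F>"
      using \<F>(2) chain unfolding subset_chain_def by (metis order_trans subsetD)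
    ultimately have "\<Union>\<F> \<in> \<F>"
      using \<F>(1) by (intro Union_in_chain)
    then show ?thesis
      using \<F> by blast
  qed
qed

text \<open>Zorn's lemma applies because a compact set inside the union of a nonempty chain of open
  sets lies inside one of them, so the union again contains no member of \<K>.\<close>

lemma maximal_openin_without_compact_subset:
  assumes "openin Y U" "\<And>K. K \<in> \<K> \<Longrightarrow> compactin Y K \<and> \<not> K \<subseteq> U"
  obtains W where "openin Y W" "U \<subseteq> W" "\<And>K. K \<in> \<K> \<Longrightarrow> \<not> K \<subseteq> W"
    "\<And>V. openin Y V \<Longrightarrow> W \<subset> V \<Longrightarrow> \<exists>K\<in>\<K>. K \<subseteq> V"
proof -
  define \<A> where "\<A> = {W. openin Y W \<and> U \<subseteq> W \<and> (\<forall>K\<in>\<K>. \<not> K \<subseteq> W)}"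
  have "\<exists>W\<in>\<A>. \<forall>V\<in>\<A>. W \<subseteq> V \<longrightarrow> V = W"
  proof (rule subset_Zorn_nonempty)
    show "\<A> \<noteq> {}"
      using assms by (auto simp: \<A>_def)
    fix \<C> assume \<C>: "\<C> \<noteq> {}" "subset.chain \<A> \<C>"
    then have "\<C> \<subseteq> \<A>"
      by (simp add: subset_chain_def)
    then have W: "openin Y W" "U \<subseteq> W" "\<forall>K\<in>\<K>. \<not> K \<subseteq> W" if "W \<in> \<C>" for W
      using that by (auto simp: \<A>_def)
    have "\<not> K \<subseteq> \<Union>\<C>" if "K \<in> \<K>" for K
      using compactin_subset_Union_chain[of Y K \<C> \<A>] assms(2) \<C> W that by metis
    moreover have "U \<subseteq> \<Union>\<C>"
      using W(2) \<C>(1) by (metis Sup_upper2 equals0I)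
    ultimately show "\<Union>\<C> \<in> \<A>"
      using W(1) by (simp add: \<A>_def openin_Union)
  qed
  then obtain W where W: "W \<in> \<A>" "\<And>V. V \<in> \<A> \<Longrightarrow> W \<subseteq> V \<Longrightarrow> V = W"
    by blast
  show thesis
  proof (rule that[of W])
    show "\<exists>K\<in>\<K>. K \<subseteq> V" if "openin Y V" "W \<subset> V" for V
    proof (rule ccontr)
      assume "\<not> ?thesis"
      then have "V \<in> \<A>"
        using W(1) that by (auto simp: \<A>_def)
      then show False
        using W(2) that(2) by blast
    qed
  qed (use W in \<open>auto simp: \<A>_def\<close>)
qed

section \<open>Filtered intersections in well-filtered spaces\<close>

lemma well_filtered_spaceD:
  assumes "well_filtered_space X" "openin X U" "filtered_family \<F>"
    "\<And>F. F \<in> \<F> \<Longrightarrow> compactin X F \<and> saturated_in X F" "\<Inter>\<F> \<subseteq> U"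
  shows "\<exists>F\<in>\<F>. F \<subseteq> U"
  using assms unfolding well_filtered_space_def by blast

lemma Inter_in_upper_points:
  assumes "well_filtered_space X" "filtered_family \<F>" "\<F> \<subseteq> upper_points X"
  shows "\<Inter>\<F> \<in> upper_points X"
proof -
  note D = well_filtered_spaceD[OF assms(1) _ assms(2)]
  have F: "F \<noteq> {}" "compactin X F" "saturated_in X F" if "F \<in> \<F>" for F
    using assms(3) that by (auto simp: upper_points_def)
  have "saturated_in X (\<Inter>\<F>)"
    using F assms(2) by (intro saturated_in_Inter) (auto simp: filtered_family_def)
  \<comment> \<open>If the intersection were empty, well-filteredness for the open set
    \<open>{}\<close> would make some member of \<F> empty.\<close>
  moreover have "\<Inter>\<F> \<noteq> {}"
    using D[of "{}"] F by auto
  moreover have "compactin X (\<Inter>\<F>)"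
    unfolding compactin_def
  proof (intro conjI allI impI)
    show "\<Inter>\<F> \<subseteq> topspace X"
      using \<open>saturated_in X (\<Inter>\<F>)\<close> by (simp add: saturated_in_def)
    fix \<C> assume \<C>: "Ball \<C> (openin X) \<and> \<Inter>\<F> \<subseteq> \<Union>\<C>"
    \<comment> \<open>Well-filteredness for this open set puts a whole member of \<F> under the
      cover, and the compactness of that member gives the finite subcover.\<close>
    then have "openin X (\<Union>\<C>)"
      by blast
    then obtain F where F': "F \<in> \<F>" "F \<subseteq> \<Union>\<C>"
      using D[of "\<Union>\<C>"] F \<C> by auto
    then obtain \<G> where "finite \<G>" "\<G> \<subseteq> \<C>" "F \<subseteq> \<Union>\<G>"
      using compactinD[OF F(2), of F \<C>] \<C> by auto
    then show "\<exists>\<G>. finite \<G> \<and> \<G> \<subseteq> \<C> \<and> \<Inter>\<F> \<subseteq> \<Union>\<G>"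
      using F'(1) by blast
  qed
  ultimately show ?thesis
    by (simp add: upper_points_def)
qed

lemma filtered_family_image:
  assumes "filtered_family \<F>" "\<And>A B. A \<in> \<F> \<Longrightarrow> B \<in> \<F> \<Longrightarrow> A \<subseteq> B \<Longrightarrow> f A \<subseteq> f B"
  shows "filtered_family (f ` \<F>)"
  unfolding filtered_family_def
proof (intro conjI ballI)
  show "f ` \<F> \<noteq> {}"
    using assms(1) by (simp add: filtered_family_def)
  fix S T assume "S \<in> f ` \<F>" "T \<in> f ` \<F>"
  then obtain A B where AB: "A \<in> \<F>" "S = f A" "B \<in> \<F>" "T = f B"
    by blast
  then obtain C where "C \<in> \<F>" "C \<subseteq> A" "C \<subseteq> B"
    using assms(1) unfolding filtered_family_def by blast
  then show "\<exists>R \<in> f ` \<F>. R \<subseteq> S \<and> R \<subseteq> T"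
    using AB assms(2) by (intro bexI[of _ "f C"]) auto
qed

section \<open>From a well-filtered space to its upper space\<close>

lemma openin_upper_space_avoiding:
  assumes "k \<in> topspace X"
  shows "openin (upper_space X) {Q \<in> upper_points X. k \<notin> Q}"
proof -
  have "{Q \<in> upper_points X. k \<notin> Q} = upper_box X (topspace X - X closure_of {k})"
    unfolding upper_box_def
  proof (rule Collect_cong, rule conj_cong)
    fix Q assume "Q \<in> upper_points X"
    then have "saturated_in X Q"
      by (simp add: upper_points_def)
    then have "Q \<subseteq> topspace X" "Q \<inter> X closure_of {k} = {} \<longleftrightarrow> k \<notin> Q"
      using saturated_in_disjoint_closure_of[OF _ assms] by (simp_all add: saturated_in_iff)
    then show "k \<notin> Q \<longleftrightarrow> Q \<subseteq> topspace X - X closure_of {k}"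
      by blast
  qed simp
  then show ?thesis
    by (simp add: openin_upper_box openin_diff)
qed

lemma well_filtered_upper_space:
  assumes wf: "well_filtered_space X"
  shows "well_filtered_space (upper_space X)"
  unfolding well_filtered_space_def
proof (intro conjI allI impI t0_upper_space)
  fix \<U> \<FF>
  assume \<U>: "openin (upper_space X) \<U>" and filt: "filtered_family \<FF>"
    and \<FF>: "\<forall>\<K>\<in>\<FF>. compactin (upper_space X) \<K> \<and> saturated_in (upper_space X) \<K>"
    and sub: "\<Inter>\<FF> \<subseteq> \<U>"
  show "\<exists>\<K>\<in>\<FF>. \<K> \<subseteq> \<U>"
  proof (rule ccontr)
    assume "\<not> ?thesis"
    then obtain \<W> where \<W>: "openin (upper_space X) \<W>" "\<U> \<subseteq> \<W>"
      and not_sub: "\<And>\<K>. \<K> \<in> \<FF> \<Longrightarrow> \<not> \<K> \<subseteq> \<W>"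
      and max: "\<And>\<V>. openin (upper_space X) \<V> \<Longrightarrow> \<W> \<subset> \<V> \<Longrightarrow> \<exists>\<K>\<in>\<FF>. \<K> \<subseteq> \<V>"
      using maximal_openin_without_compact_subset[OF \<U>, of \<FF>] \<FF> by metis
    define u where "u = (\<lambda>\<K>. \<Union>(\<K> - \<W>))"
    define L where "L = \<Inter>(u ` \<FF>)"
    have pts: "\<K> \<subseteq> upper_points X" if "\<K> \<in> \<FF>" for \<K>
      using \<FF> that by (auto simp: saturated_in_iff topspace_upper_space)
    have u: "u ` \<FF> \<subseteq> upper_points X"
    proof clarify
      fix \<K> assume \<K>: "\<K> \<in> \<FF>"
      \<comment> \<open>This exhibits the difference as a closed part of a compact set.\<close>
      have "\<K> - \<W> = (topspace (upper_space X) - \<W>) \<inter> \<K>"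
        using pts[OF \<K>] by (auto simp: topspace_upper_space)
      then have "compactin (upper_space X) (\<K> - \<W>)"
        using \<FF> \<K> \<W>(1) by (simp add: closed_Int_compactin closedin_diff)
      then have "compactin X (u \<K>)"
        unfolding u_def by (rule compactin_Union_upper_space)
      moreover have "saturated_in X (u \<K>)"
        unfolding u_def using pts[OF \<K>] by (intro saturated_in_Union) (auto simp: upper_points_def)
      moreover have "u \<K> \<noteq> {}"
      proof -
        obtain Q where "Q \<in> \<K>" "Q \<notin> \<W>"
          using not_sub[OF \<K>] by blast
        moreover have "Q \<noteq> {}"
          using pts[OF \<K>] \<open>Q \<in> \<K>\<close> by (auto simp: upper_points_def)
        ultimately show ?thesis
          by (auto simp: u_def)
      qed
      ultimately show "u \<K> \<in> upper_points X"
        by (simp add: upper_points_def)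
    qed
    have filt_u: "filtered_family (u ` \<FF>)"
      by (rule filtered_family_image[OF filt]) (auto simp: u_def)
    have L: "L \<in> upper_points X"
      unfolding L_def using wf filt_u u by (rule Inter_in_upper_points)
    have "L \<notin> \<W>"
    proof
      assume "L \<in> \<W>"
      \<comment> \<open>Well-filteredness of \<open>X\<close> places some \<open>u \<K>\<close>
        inside \<open>U\<close>. Then every point of \<open>\<K> - \<W>\<close> falls into the box
        of \<open>U\<close>, hence into \<W>, which is absurd as \<K> is not contained in
        \<W>.\<close>
      then obtain U where U: "openin X U" "L \<subseteq> U" "upper_box X U \<subseteq> \<W>"
        using \<W>(1) by (auto simp: openin_upper_space_iff)
      then obtain \<K> where \<K>: "\<K> \<in> \<FF>" "u \<K> \<subseteq> U"
      proof -
        have "compactin X F \<and> saturated_in X F" if "F \<in> u ` \<FF>" for F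
          using u that by (auto simp: upper_points_def)
        moreover have "\<Inter>(u ` \<FF>) \<subseteq> U"
          using U(2) by (simp add: L_def)
        ultimately have "\<exists>F \<in> u ` \<FF>. F \<subseteq> U"
          by (rule well_filtered_spaceD[OF wf U(1) filt_u])
        then show thesis
          using that by (metis imageE)
      qed
      obtain Q where Q: "Q \<in> \<K>" "Q \<notin> \<W>"
        using not_sub[OF \<K>(1)] by blast
      then have "Q \<subseteq> u \<K>"
        by (auto simp: u_def)
      then have "Q \<in> upper_box X U"
        using \<K> pts[OF \<K>(1)] Q(1) by (auto simp: upper_box_def)
      then show False
        using Q U(3) by blast
    qed
    have contains: "k \<in> Q" if k: "k \<in> L" and Q: "Q \<in> upper_points X" "Q \<notin> \<W>" for k Q
    proof (rule ccontr)
      assume "k \<notin> Q"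
      \<comment> \<open>This open set gains the point \<open>Q\<close>, so by maximality it contains
        some \<K>. All points of \<open>\<K> - \<W>\<close> then avoid \<open>k\<close>, although
        \<open>k\<close> lies in their union \<open>u \<K>\<close>.\<close>
      let ?V = "\<W> \<union> {P \<in> upper_points X. k \<notin> P}"
      have "k \<in> topspace X"
        using L k by (auto simp: upper_points_def saturated_in_iff)
      then have "openin (upper_space X) ?V"
        using \<W>(1) by (intro openin_Un openin_upper_space_avoiding)
      moreover have "\<W> \<subset> ?V"
        using Q \<open>k \<notin> Q\<close> by blast
      ultimately obtain \<K> where \<K>: "\<K> \<in> \<FF>" "\<K> \<subseteq> ?V"
        using max by metis
      then have "k \<in> \<Union>(\<K> - \<W>)"
        using k by (simp add: L_def u_def)
      then show False
        using \<K>(2) by auto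
    qed
    have "L \<in> \<K>" if \<K>: "\<K> \<in> \<FF>" for \<K>
    proof -
      obtain Q where Q: "Q \<in> \<K>" "Q \<notin> \<W>"
        using not_sub[OF \<K>] by blast
      \<comment> \<open>A saturated set of the upper space is closed under passing to smaller
        points, so \<open>L\<close> joins \<open>Q\<close> in \<K>.\<close>
      then have "L \<subseteq> Q"
        using contains pts[OF \<K>] by blast
      then show ?thesis
        using saturated_in_upper_space_mono[OF _ Q(1) _ L] \<FF> \<K> by metis
    qed
    then have "L \<in> \<Inter>\<FF>"
      by (rule InterI)
    then show False
      using sub \<W>(2) \<open>L \<notin> \<W>\<close> by (metis subsetD)
  qed
qed

section \<open>From the upper space back to the space\<close>

lemma well_filtered_of_upper_space:
  assumes "t0_space X" and wf: "well_filtered_space (upper_space X)"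
  shows "well_filtered_space X"
  unfolding well_filtered_space_def
proof (intro conjI allI impI assms(1))
  fix U \<F>
  assume U: "openin X U" and filt: "filtered_family \<F>"
    and \<F>: "\<forall>F\<in>\<F>. compactin X F \<and> saturated_in X F" and sub: "\<Inter>\<F> \<subseteq> U"
  show "\<exists>F\<in>\<F>. F \<subseteq> U"
  \<comment> \<open>The empty set is not a point of the upper space; if it belongs to \<F>, it is
    itself a member inside \<open>U\<close>.\<close>
  proof (cases "{} \<in> \<F>")
    case False
    then have pts: "F \<in> upper_points X" if "F \<in> \<F>" for F
      using \<F> that by (auto simp: upper_points_def)
    have "\<exists>\<K> \<in> upper_box X ` \<F>. \<K> \<subseteq> upper_box X U"
    proof (rule well_filtered_spaceD[OF wf openin_upper_box[OF U]])
      show "filtered_family (upper_box X ` \<F>)"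
        by (rule filtered_family_image[OF filt]) (auto simp: upper_box_def)
      show "compactin (upper_space X) \<K> \<and> saturated_in (upper_space X) \<K>"
        if "\<K> \<in> upper_box X ` \<F>" for \<K>
        using that pts \<F> by (auto intro: compactin_upper_box saturated_in_upper_box)
      show "\<Inter>(upper_box X ` \<F>) \<subseteq> upper_box X U"
      proof
        fix Q assume Q: "Q \<in> \<Inter>(upper_box X ` \<F>)"
        \<comment> \<open>Nonemptiness of \<F> ensures that \<open>Q\<close> lies in at least one
          box and so is a point of the upper space.\<close>
        obtain F where "F \<in> \<F>"
          using filt by (auto simp: filtered_family_def)
        then have "Q \<in> upper_points X"
          using Q by (auto simp: upper_box_def)
        moreover have "Q \<subseteq> \<Inter>\<F>"
          using Q by (auto simp: upper_box_def)
        ultimately show "Q \<in> upper_box X U"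
          using sub by (simp add: upper_box_def)
      qed
    qed
    \<comment> \<open>Each \<open>F\<close> belongs to its own box, so inclusion of that box in the
      box of \<open>U\<close> yields \<open>F \<subseteq> U\<close>.\<close>
    then show ?thesis
      using pts by (auto simp: upper_box_def)
  qed blast
qed

theorem theorem4:
  fixes X :: "'a topology"
  assumes "t0_space X"
  shows "well_filtered_space X \<longleftrightarrow> well_filtered_space (upper_space X)"
  using assms well_filtered_upper_space well_filtered_of_upper_space by blast

end
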